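(* Let $A$ be a real $n\times n$ matrix and let $S(A)=(A+i)\mathbb{R}^n=\{Ax+ix: x\in\mathbb{R}^n\}\subset\mathbb{C}^n$. Then $\mathbb{R}^n\cup S(A)$ is Lagrangian with respect to some Kähler form on $\mathbb{C}^n$ if and only if $A$ is diagonalizable over the reals.
   Context: Here $\mathbb{R}^n$ denotes $\{z\in\mathbb{C}^n:\operatorname{Im}z=0\}\subset\mathbb{C}^n$. A Kähler form on $\mathbb{C}^n$ is a smooth closed real $(1,1)$-form that is positive definite at every point of $\mathbb{C}^n$ (its coefficients need not be constant). The union $\mathbb{R}^n\cup S(A)$ is Lagrangian with respect to a Kähler form $\omega$ if the pull-back of $\omega$ to each of the two real $n$-dimensional planes $\mathbb{R}^n$ and $S(A)$ (under the inclusion into $\mathbb{C}^n$) vanishes identically. *)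

theory Defs
  imports "HOL-Analysis.Analysis"
begin

section \<open>Smooth functions\<close>

text \<open>A function on a finite-dimensional space is of class \<open>C\<^sup>k\<close> if all its iterated directional
  derivatives up to order \<open>k\<close> exist (as values of Frechet derivatives) and are continuous.\<close>

primrec of_class_C :: "nat \<Rightarrow> ('a::euclidean_space \<Rightarrow> 'b::real_normed_vector) \<Rightarrow> bool" where
  "of_class_C 0 f \<longleftrightarrow> continuous_on UNIV f"
| "of_class_C (Suc k) f \<longleftrightarrow>
     (\<forall>x. f differentiable (at x)) \<and> (\<forall>v. of_class_C k (\<lambda>x. frechet_derivative f (at x) v))"

definition smooth :: "('a::euclidean_space \<Rightarrow> 'b::real_normed_vector) \<Rightarrow> bool" where
  "smooth f \<longleftrightarrow> (\<forall>k. of_class_C k f)"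


section \<open>Real two-forms and Kaehler forms on complex n-space\<close>

text \<open>A real 2-form on \<open>\<complex>\<^sup>n\<close> is a map \<open>\<omega>\<close> whose value \<open>\<omega> p\<close> at each point \<open>p\<close> is an alternating
  \<open>\<real>\<close>-bilinear form on the tangent space at \<open>p\<close>, which is identified with \<open>\<complex>\<^sup>n\<close> itself.\<close>

type_synonym 'n form2 = "complex^'n \<Rightarrow> complex^'n \<Rightarrow> complex^'n \<Rightarrow> real"

definition real_2_form :: "'n::finite form2 \<Rightarrow> bool" where
  "real_2_form \<omega> \<longleftrightarrow> (\<forall>p. bilinear (\<omega> p) \<and> (\<forall>u. \<omega> p u u = 0))"

text \<open>Evaluating \<open>\<omega>\<close> on constant vector fields gives all of its coefficient functions, up to
  linear combinations with constant coefficients.\<close>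

definition smooth_form :: "'n::finite form2 \<Rightarrow> bool" where
  "smooth_form \<omega> \<longleftrightarrow> (\<forall>u v. smooth (\<lambda>p. \<omega> p u v))"

text \<open>The invariant formula for \<open>d\<omega>\<close>, evaluated on constant vector fields; these commute, so that
  the terms containing Lie brackets are absent.\<close>

definition ext_deriv ::
  "'n::finite form2 \<Rightarrow> complex^'n \<Rightarrow> complex^'n \<Rightarrow> complex^'n \<Rightarrow> complex^'n \<Rightarrow> real" where
  "ext_deriv \<omega> p u v w =
     frechet_derivative (\<lambda>q. \<omega> q v w) (at p) u
   - frechet_derivative (\<lambda>q. \<omega> q u w) (at p) v
   + frechet_derivative (\<lambda>q. \<omega> q u v) (at p) w"

definition closed_form :: "'n::finite form2 \<Rightarrow> bool" where
  "closed_form \<omega> \<longleftrightarrow> (\<forall>p u v w. ext_deriv \<omega> p u v w = 0)"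

definition dz :: "'n::finite \<Rightarrow> complex^'n \<Rightarrow> complex" where
  "dz j u = u $ j"

definition dzbar :: "'n::finite \<Rightarrow> complex^'n \<Rightarrow> complex" where
  "dzbar j u = cnj (u $ j)"

definition wedge :: "('a \<Rightarrow> complex) \<Rightarrow> ('a \<Rightarrow> complex) \<Rightarrow> 'a \<Rightarrow> 'a \<Rightarrow> complex" where
  "wedge \<alpha> \<beta> u v = \<alpha> u * \<beta> v - \<alpha> v * \<beta> u"

definition type_1_1 :: "'n::finite form2 \<Rightarrow> bool" where
  "type_1_1 \<omega> \<longleftrightarrow> (\<exists>h :: complex^'n \<Rightarrow> 'n \<Rightarrow> 'n \<Rightarrow> complex. \<forall>p u v.
     complex_of_real (\<omega> p u v) =
       (\<Sum>j\<in>UNIV. \<Sum>k\<in>UNIV. h p j k * wedge (dz j) (dzbar k) u v))"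

text \<open>The sign convention is the one for which the standard form
  \<open>(\<i>/2) \<Sum>\<^sub>j dz\<^sub>j \<and> d(cnj z\<^sub>j)\<close> is positive: for it, \<open>\<omega>(u, \<i>u) = |u|\<^sup>2\<close>.\<close>

definition positive_form :: "'n::finite form2 \<Rightarrow> bool" where
  "positive_form \<omega> \<longleftrightarrow> (\<forall>p u. u \<noteq> 0 \<longrightarrow> \<omega> p u (\<i> *s u) > 0)"

definition kaehler_form :: "'n::finite form2 \<Rightarrow> bool" where
  "kaehler_form \<omega> \<longleftrightarrow>
     real_2_form \<omega> \<and> smooth_form \<omega> \<and> closed_form \<omega> \<and> type_1_1 \<omega> \<and> positive_form \<omega>"


section \<open>The two planes and the Lagrangian condition\<close>

definition complexify :: "real^'n \<Rightarrow> complex^'n::finite" where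
  "complexify x = (\<chi> j. complex_of_real (x $ j))"

definition real_plane :: "(complex^'n::finite) set" where
  "real_plane = {z. \<forall>j. Im (z $ j) = 0}"

definition S_plane :: "real^'n^'n \<Rightarrow> (complex^'n::finite) set" where
  "S_plane A = {complexify (A *v x) + \<i> *s complexify x | x. True}"

text \<open>Intended for real linear subspaces \<open>V\<close>: the tangent space of \<open>V\<close> at each of its points is
  again \<open>V\<close>, so the pull-back of \<open>\<omega>\<close> under the inclusion is \<open>\<omega> p\<close> restricted to \<open>V \<times> V\<close>, for \<open>p \<in> V\<close>.\<close>

definition pullback_vanishes_on :: "'n::finite form2 \<Rightarrow> (complex^'n) set \<Rightarrow> bool" where
  "pullback_vanishes_on \<omega> V \<longleftrightarrow> (\<forall>p\<in>V. \<forall>u\<in>V. \<forall>v\<in>V. \<omega> p u v = 0)"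

definition lagrangian_union :: "'n::finite form2 \<Rightarrow> (complex^'n) set \<Rightarrow> (complex^'n) set \<Rightarrow> bool" where
  "lagrangian_union \<omega> V W \<longleftrightarrow> pullback_vanishes_on \<omega> V \<and> pullback_vanishes_on \<omega> W"


section \<open>Real diagonalizability\<close>

definition diagonalizable_over_reals :: "real^'n^'n::finite \<Rightarrow> bool" where
  "diagonalizable_over_reals A \<longleftrightarrow>
     (\<exists>P D :: real^'n^'n. invertible P \<and> (\<forall>i j. i \<noteq> j \<longrightarrow> D $ i $ j = 0) \<and>
        A = P ** D ** matrix_inv P)"

end

theory Submission
  imports Defs
begin

text \<open>For a Lagrangian pair, the inner product \<open>G x y = \<omega>(x, \<i>y)\<close> at the origin makes \<open>A\<close>
  self-adjoint on \<open>\<real>\<^sup>n\<close>: expanding \<open>\<omega>(Ax + \<i>x, Ay + \<i>y) = 0\<close> leaves only \<open>G (Ax) y - G (Ay) x\<close>.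
  Conversely, if \<open>Q\<close> diagonalizes \<open>A\<close>, then the pull-back of the standard Kaehler form under the
  complex linear extension of \<open>Q\<close> works.\<close>

section \<open>Self-adjoint maps for an arbitrary inner product\<close>

text \<open>Maximize the Rayleigh quotient \<open>G (f x) x / G x x\<close> on the unit sphere of
  \<open>S\<close>. With the maximum \<open>c\<close>, the form \<open>c G - G (f _) _\<close> is
  positive semidefinite on \<open>S\<close> and vanishes at the maximizer, which forces
  \<open>f v = c v\<close>.\<close>

lemma eigenvector_if_selfadjoint:
  fixes f :: "'a::euclidean_space \<Rightarrow> 'a" and G :: "'a \<Rightarrow> 'a \<Rightarrow> real"
  assumes f: "linear f" and G: "bilinear G"
    and sym: "\<And>x y. G x y = G y x" and pos: "\<And>x. x \<noteq> 0 \<Longrightarrow> G x x > 0"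
    and selfadj: "\<And>x y. G (f x) y = G x (f y)"
    and S: "subspace S" "f ` S \<subseteq> S" "S \<noteq> {0}"
  obtains v c where "v \<in> S" "v \<noteq> 0" "f v = c *\<^sub>R v"
proof -
  interpret G: bounded_bilinear G
    using G by (simp add: bilinear_conv_bounded_bilinear)
  interpret f: linear f by (fact f)
  let ?K = "S \<inter> sphere 0 1"
  let ?R = "\<lambda>x. G (f x) x / G x x"
  have "compact ?K"
    using closed_subspace[OF S(1)] by (simp add: closed_Int_compact)
  moreover obtain s where s: "s \<in> S" "s \<noteq> 0"
    using S(1,3) subspace_0 by blast
  then have "s /\<^sub>R norm s \<in> ?K"
    using S(1) by (auto simp: subspace_scale)
  then have "?K \<noteq> {}" by blast
  moreover have "continuous_on ?K ?R"
  proof (intro continuous_on_divide G.continuous_on linear_continuous_on bounded_linear_ident ballI)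
    show "bounded_linear f" using f by (simp add: linear_linear)
    show "G x x \<noteq> 0" if "x \<in> ?K" for x using pos[of x] that by force
  qed
  ultimately obtain v where v: "v \<in> ?K" and max: "\<And>x. x \<in> ?K \<Longrightarrow> ?R x \<le> ?R v"
    using continuous_attains_sup[of ?K ?R] by blast
  have vS: "v \<in> S" and v0: "v \<noteq> 0" using v by auto
  define c where "c = ?R v"
  define H where "H x y = G (c *\<^sub>R x - f x) y" for x y
  have Hvv: "H v v = 0"
    using pos[OF v0] by (simp add: H_def c_def G.diff_left G.scaleR_left)
  have Hpos: "H x x \<ge> 0" if "x \<in> S" for x
  proof (cases "x = 0")
    case False
    \<comment> \<open>The quotient is homogeneous of degree 0, so its bound on the unit sphere
      carries over to every nonzero vector of \<open>S\<close>.\<close>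
    have "x /\<^sub>R norm x \<in> ?K"
      using S(1) that False by (auto simp: subspace_scale)
    from max[OF this] have "G (f x) x / G x x \<le> c"
      using False by (simp add: c_def f.scale G.scaleR_left G.scaleR_right)
    then show ?thesis
      using pos[OF False] by (simp add: H_def G.diff_left G.scaleR_left divide_le_eq)
  qed (simp add: H_def G.zero_right)
  \<comment> \<open>The eigenvector defect serves as its own test direction: \<open>H v w\<close> is
    then \<open>G w w\<close>, which is positive unless \<open>w = 0\<close>.\<close>
  define w where "w = c *\<^sub>R v - f v"
  have wS: "w \<in> S"
    using S vS by (auto simp: w_def intro!: subspace_diff subspace_scale)
  have Hvw: "H v w = G w w" by (simp add: H_def w_def)
  have Hwv: "H w v = G w w"
  proof -
    have "H w v = G w (c *\<^sub>R v - f v)"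
      by (simp add: H_def G.diff_left G.diff_right G.scaleR_left G.scaleR_right selfadj)
    then show ?thesis by (simp add: w_def)
  qed
  \<comment> \<open>A positive semidefinite form vanishing at \<open>(v, v)\<close> has \<open>v\<close> in its radical.\<close>
  have key: "0 \<le> 2 * t * G w w + t\<^sup>2 * H w w" for t
  proof -
    have "0 \<le> H (v + t *\<^sub>R w) (v + t *\<^sub>R w)"
      using S(1) vS wS by (intro Hpos subspace_add subspace_scale)
    also have "\<dots> = H v v + t * H v w + t * H w v + t\<^sup>2 * H w w"
      by (simp add: H_def G.diff_left G.add_left G.add_right G.scaleR_left G.scaleR_right
          f.add f.scale power2_eq_square algebra_simps)
    finally show ?thesis by (simp add: Hvv Hvw Hwv)
  qed
  have "w = 0"
  proof (rule ccontr)
    assume "w \<noteq> 0"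
    note Gw = pos[OF this] and Hw = Hpos[OF wS]
    \<comment> \<open>A negative \<open>t\<close> so small that the linear term outweighs the
      quadratic one; the added 1 keeps the denominator positive even if
      \<open>H w w = 0\<close>.\<close>
    define t where "t = - G w w / (1 + H w w)"
    have "2 * t * G w w + t\<^sup>2 * H w w = t * (2 * G w w + t * H w w)"
      by (simp add: power2_eq_square algebra_simps)
    also have "2 * G w w + t * H w w = G w w * (2 + H w w) / (1 + H w w)"
      using Hw by (simp add: t_def field_simps)
    also have "t * \<dots> < 0"
      using Gw Hw by (intro mult_neg_pos divide_pos_pos mult_pos_pos) (simp_all add: t_def)
    finally show False using key[of t] by linarith
  qed
  then have "f v = c *\<^sub>R v" by (simp add: w_def)
  then show thesis using that vS v0 by blast
qed

text \<open>The map \<open>M\<close> represents \<open>G\<close> through the Euclidean inner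
  product. Positivity makes it injective, hence surjective, so a Euclidean normal vector of
  \<open>span E\<close> has a preimage, which is \<open>G\<close>-orthogonal to
  \<open>span E\<close>.\<close>

lemma orthogonal_vector_exists:
  fixes G :: "'a::euclidean_space \<Rightarrow> 'a \<Rightarrow> real"
  assumes G: "bilinear G" and pos: "\<And>x. x \<noteq> 0 \<Longrightarrow> G x x > 0"
    and E: "span E \<noteq> UNIV"
  obtains x where "x \<noteq> 0" "\<And>e. e \<in> span E \<Longrightarrow> G x e = 0"
proof -
  interpret G: bounded_bilinear G
    using G by (simp add: bilinear_conv_bounded_bilinear)
  define M where "M x = (\<Sum>b\<in>Basis. G x b *\<^sub>R b)" for x
  have M: "M x \<bullet> y = G x y" for x y
  proof -
    have "G x y = (\<Sum>b\<in>Basis. (y \<bullet> b) * G x b)"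
      by (subst euclidean_representation[of y, symmetric]) (simp only: G.sum_right G.scaleR_right real_scaleR_def)
    then show ?thesis
      by (simp add: M_def inner_sum_left inner_commute[of y] mult.commute)
  qed
  have lin: "linear M"
    by (rule linearI)
      (simp_all add: M_def G.add_left G.scaleR_left scaleR_left_distrib sum.distrib
        scaleR_sum_right)
  have "inj M"
    using M pos by (subst linear_injective_0[OF lin]) (metis inner_zero_left less_irrefl)
  then have "surj M" using linear_injective_imp_surjective[OF lin] by blast
  obtain w where w: "w \<noteq> 0" "\<And>e. e \<in> span E \<Longrightarrow> w \<bullet> e = 0"
    using span_not_UNIV_orthogonal[OF E] by blast
  obtain x where x: "M x = w" using \<open>surj M\<close> by (metis surjD)
  show thesis
  proof
    show "x \<noteq> 0" using x w(1) linear_0[OF lin] by auto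
    show "G x e = 0" if "e \<in> span E" for e using w(2)[OF that] x M by metis
  qed
qed

text \<open>Otherwise the \<open>G\<close>-orthogonal complement \<open>S\<close> of all
  eigenvectors is nonzero. It is invariant, since \<open>G (f x) e = G x (f e) = c * G x e\<close>
  for an eigenvector \<open>e\<close>, so it contains an eigenvector, which is orthogonal to
  itself.\<close>

lemma selfadjoint_span_eigenvectors:
  fixes f :: "'a::euclidean_space \<Rightarrow> 'a" and G :: "'a \<Rightarrow> 'a \<Rightarrow> real"
  assumes f: "linear f" and G: "bilinear G"
    and sym: "\<And>x y. G x y = G y x" and pos: "\<And>x. x \<noteq> 0 \<Longrightarrow> G x x > 0"
    and selfadj: "\<And>x y. G (f x) y = G x (f y)"
  shows "span {v. \<exists>c. f v = c *\<^sub>R v} = UNIV"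
proof (rule ccontr)
  interpret G: bounded_bilinear G
    using G by (simp add: bilinear_conv_bounded_bilinear)
  let ?E = "{v. \<exists>c. f v = c *\<^sub>R v}"
  define S where "S = {x. \<forall>e\<in>?E. G x e = 0}"
  assume "span ?E \<noteq> UNIV"
  then obtain x where "x \<noteq> 0" "\<And>e. e \<in> span ?E \<Longrightarrow> G x e = 0"
    using orthogonal_vector_exists[of G, OF G pos] by blast
  then have "x \<in> S" "x \<notin> {0}" unfolding S_def by (blast intro: span_base)+
  then have "S \<noteq> {0}" by blast
  moreover have "subspace S"
    by (auto simp: S_def subspace_def G.zero_left G.add_left G.scaleR_left)
  moreover have "f ` S \<subseteq> S"
    by (auto simp: S_def selfadj G.scaleR_right)
  ultimately obtain v c where "v \<in> S" "v \<noteq> 0" "f v = c *\<^sub>R v"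
    using eigenvector_if_selfadjoint[of f G S, OF f G sym pos selfadj] by blast
  then have "G v v = 0" by (auto simp: S_def)
  then show False using pos[OF \<open>v \<noteq> 0\<close>] by simp
qed

lemma matrix_inv_left_right:
  assumes "invertible A"
  shows matrix_inv_left: "matrix_inv A ** A = mat 1" and matrix_inv_right: "A ** matrix_inv A = mat 1"
  using someI_ex[OF assms[unfolded invertible_def], folded matrix_inv_def] by blast+

lemma diagonalizable_if_span_eigenvectors:
  fixes A :: "real^'n^'n::finite"
  assumes "span {v. \<exists>c. A *v v = c *\<^sub>R v} = UNIV"
  shows "diagonalizable_over_reals A"
proof -
  let ?E = "{v. \<exists>c. A *v v = c *\<^sub>R v}"
  obtain B where B: "B \<subseteq> ?E" "independent B" "?E \<subseteq> span B" "card B = dim ?E"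
    by (rule basis_exists)
  have spanB: "span B = UNIV"
    using span_mono[OF B(3)] assms by (simp add: span_span top.extremum_unique)
  have "dim ?E = dim (span ?E)" by (simp only: dim_span)
  also have "\<dots> = CARD('n)" unfolding assms by simp
  finally have "dim ?E = CARD('n)" .
  then have "card B = card (UNIV :: 'n set)" using B by simp
  moreover have "finite B" using B(2) by (rule independent_imp_finite)
  ultimately obtain b :: "'n \<Rightarrow> real^'n" where b: "bij_betw b UNIV B"
    using finite_same_card_bij[of "UNIV :: 'n set" B] by auto
  have "\<forall>j. \<exists>c. A *v b j = c *\<^sub>R b j"
    using b B(1) by (auto simp: bij_betw_def)
  then obtain c where c: "\<And>j. A *v b j = c j *\<^sub>R b j" by metis
  \<comment> \<open>The eigenbasis forms the columns of \<open>P\<close>; comparing columns then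
    turns \<open>A *v b j = c j *\<^sub>R b j\<close> into \<open>A ** P = P ** D\<close>.\<close>
  define P :: "real^'n^'n" where "P = (\<chi> i j. b j $ i)"
  define D :: "real^'n^'n" where "D = (\<chi> i j. if i = j then c j else 0)"
  have "columns P = B"
    using b by (auto simp: columns_def column_def P_def bij_betw_def)
  then have "\<exists>P'. P ** P' = mat 1"
    using spanB by (simp add: matrix_right_invertible_span_columns span_vec_eq)
  then have P: "invertible P"
    by (simp add: invertible_right_inverse)
  have "A ** P = P ** D"
  proof -
    have "(A ** P) $ i $ j = (P ** D) $ i $ j" for i j
    proof -
      have "(A ** P) $ i $ j = (A *v b j) $ i"
        by (simp add: matrix_matrix_mult_def matrix_vector_mult_def P_def)
      also have "\<dots> = (P ** D) $ i $ j"
        by (simp add: c matrix_matrix_mult_def P_def D_def if_distrib cong: if_cong)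
      finally show ?thesis .
    qed
    then show ?thesis by (simp add: vec_eq_iff)
  qed
  then have "A = P ** D ** matrix_inv P"
    using matrix_inv_right[OF P] by (metis matrix_mul_assoc matrix_mul_rid)
  then show ?thesis
    using P unfolding diagonalizable_over_reals_def
    by (intro exI[of _ P] exI[of _ D]) (simp add: D_def)
qed

section \<open>From a Kaehler form to an inner product\<close>

text \<open>Multiplication by \<open>\<i>\<close> scales \<open>dz j\<close> by \<open>\<i>\<close>
  and \<open>dzbar k\<close> by \<open>-\<i>\<close>, and these factors multiply to 1.\<close>

lemma type_1_1_i_invariant:
  assumes "type_1_1 \<omega>"
  shows "\<omega> p (\<i> *s u) (\<i> *s v) = \<omega> p u v"
proof -
  have "wedge (dz j) (dzbar k) (\<i> *s u) (\<i> *s v) = wedge (dz j) (dzbar k) u v" for j k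
    by (simp add: wedge_def dz_def dzbar_def complex_eq_iff)
  then show ?thesis
    using assms unfolding type_1_1_def by (metis (no_types, lifting) of_real_eq_iff sum.cong)
qed

lemma linear_complexify: "linear complexify"
  by (rule linearI) (simp_all add: complexify_def vec_eq_iff complex_eq_iff)

lemma complexify_eq_0_iff: "complexify x = 0 \<longleftrightarrow> x = 0"
  by (simp add: complexify_def vec_eq_iff)

lemma complexify_in_real_plane: "complexify x \<in> real_plane"
  by (simp add: complexify_def real_plane_def)

lemma linear_i_complexify: "linear (\<lambda>x. \<i> *s complexify x)"
  by (rule linearI) (simp_all add: complexify_def vec_eq_iff complex_eq_iff)

lemma lagrangian_imp_diagonalizable:
  fixes \<omega> :: "'n::finite form2" and A :: "real^'n^'n"
  assumes \<omega>: "kaehler_form \<omega>" and lag: "lagrangian_union \<omega> real_plane (S_plane A)"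
  shows "diagonalizable_over_reals A"
proof -
  define W where "W = \<omega> 0"
  have biW: "bilinear W" and alt: "W u u = 0" and inv: "W (\<i> *s u) (\<i> *s v) = W u v"
    and posW: "u \<noteq> 0 \<Longrightarrow> W u (\<i> *s u) > 0" for u v
    using \<omega> type_1_1_i_invariant
    by (auto simp: kaehler_form_def real_2_form_def positive_form_def W_def)
  interpret W: bounded_bilinear W
    using biW by (simp add: bilinear_conv_bounded_bilinear)
  have skew: "W u v = - W v u" for u v
    using alt[of "u + v"] alt[of u] alt[of v] by (simp add: W.add_left W.add_right)
  have "(0 :: complex^'n) \<in> real_plane" by (simp add: real_plane_def)
  then have real: "W (complexify x) (complexify y) = 0" for x y
    using lag complexify_in_real_plane
    unfolding lagrangian_union_def pullback_vanishes_on_def W_def by blast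
  have S: "W (complexify (A *v x) + \<i> *s complexify x) (complexify (A *v y) + \<i> *s complexify y) = 0"
    for x y
  proof -
    have "(0 :: complex^'n) \<in> S_plane A"
      unfolding S_plane_def
      by (auto intro!: exI[of _ 0] simp: complexify_def vec_eq_iff)
    then show ?thesis
      using lag unfolding lagrangian_union_def pullback_vanishes_on_def W_def S_plane_def
      by blast
  qed
  \<comment> \<open>The Riemannian metric of the Kaehler form at the origin, restricted to the real
    directions.\<close>
  define G where "G x y = W (complexify x) (\<i> *s complexify y)" for x y
  have biG: "bilinear G"
    unfolding bilinear_def G_def
  proof (intro conjI allI)
    show "linear (\<lambda>y. W (complexify x) (\<i> *s complexify y))" for x
      using linear_compose[OF linear_i_complexify, of "W (complexify x)"] biW
      by (simp add: bilinear_def o_def)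
    show "linear (\<lambda>x. W (complexify x) (\<i> *s complexify y))" for y
      using linear_compose[OF linear_complexify, of "\<lambda>u. W u (\<i> *s complexify y)"] biW
      by (simp add: bilinear_def o_def)
  qed
  have symG: "G x y = G y x" for x y
  proof -
    \<comment> \<open>Applying \<open>\<i>\<close> to both arguments preserves \<open>W\<close>; the
      resulting sign cancels against the skew symmetry of \<open>W\<close>.\<close>
    have "\<i> *s (\<i> *s complexify y) = - complexify y"
      by (simp add: vec_eq_iff)
    then have "G x y = W (\<i> *s complexify x) (- complexify y)"
      unfolding G_def by (metis inv)
    also have "\<dots> = G y x"
      using skew[of "\<i> *s complexify x"] by (simp add: W.minus_right G_def)
    finally show ?thesis .
  qed
  have posG: "G x x > 0" if "x \<noteq> 0" for x
    unfolding G_def using posW that by (simp add: complexify_eq_0_iff)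
  have selfadj: "G (A *v x) y = G x (A *v y)" for x y
  proof -
    \<comment> \<open>The real-real term vanishes by \<open>real\<close>, and \<open>inv\<close>
      reduces the imaginary-imaginary term to it; only the two mixed terms survive.\<close>
    have "G (A *v x) y - G (A *v y) x = 0"
      using S[of x y] skew[of "\<i> *s complexify x" "complexify (A *v y)"]
      by (simp add: W.add_left W.add_right real inv G_def)
    then show ?thesis using symG[of x] by simp
  qed
  show ?thesis
    using selfadjoint_span_eigenvectors[of "(*v) A" G,
        OF matrix_vector_mul_linear biG symG posG selfadj]
    by (rule diagonalizable_if_span_eigenvectors)
qed

section \<open>A constant Kaehler form from a diagonalization\<close>

text \<open>Directional derivatives of a constant are the constant 0, hence the generalization over
  \<open>c\<close> in the induction.\<close>

lemma of_class_C_const: "of_class_C k (\<lambda>_. c)"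
  by (induction k arbitrary: c) (simp_all)

definition cmat :: "real^'n^'n \<Rightarrow> complex^'n \<Rightarrow> complex^'n::finite" where
  "cmat Q u = (\<chi> j. \<Sum>k\<in>UNIV. complex_of_real (Q $ j $ k) * u $ k)"

text \<open>The pull-back of the standard form under \<open>cmat Q\<close>:
  \<open>Im (cnj a * b)\<close> is the standard area form on one complex coordinate. Nothing depends
  on the base point \<open>p\<close>.\<close>

definition const_form :: "real^'n^'n \<Rightarrow> 'n::finite form2" where
  "const_form Q p u v = (\<Sum>j\<in>UNIV. Im (cnj (cmat Q u $ j) * cmat Q v $ j))"

lemma cmat_add: "cmat Q (u + v) = cmat Q u + cmat Q v"
  by (simp add: cmat_def vec_eq_iff algebra_simps sum.distrib)

lemma cmat_scaleR: "cmat Q (r *\<^sub>R u) = r *\<^sub>R cmat Q u"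
  by (simp add: cmat_def vec_eq_iff scaleR_sum_right)

lemma cmat_scale: "cmat Q (c *s u) = c *s cmat Q u"
  by (simp add: cmat_def vec_eq_iff sum_distrib_left algebra_simps)

lemma cmat_complexify: "cmat Q (complexify x) = complexify (Q *v x)"
  by (simp add: cmat_def complexify_def vec_eq_iff matrix_vector_mult_def)

lemma cmat_mult: "cmat P (cmat Q u) = cmat (P ** Q) u"
  unfolding cmat_def vec_eq_iff
  by (auto simp: matrix_matrix_mult_def sum_distrib_left sum_distrib_right mult.assoc
      intro: sum.swap)

lemma cmat_one: "cmat (mat 1) u = u"
  by (simp add: cmat_def vec_eq_iff mat_def if_distrib if_distribR cong: if_cong)

lemma kaehler_const_form:
  fixes Q :: "real^'n^'n::finite"
  assumes "invertible Q"
  shows "kaehler_form (const_form Q)"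
  unfolding kaehler_form_def
proof (intro conjI)
  have "bilinear (const_form Q p)" for p
    unfolding bilinear_def const_form_def
    by (auto intro!: linearI simp: cmat_add cmat_scaleR sum_distrib_left algebra_simps
        simp flip: sum.distrib)
  then show "real_2_form (const_form Q)"
    by (auto simp: real_2_form_def const_form_def algebra_simps)
  show "smooth_form (const_form Q)"
    by (simp add: smooth_form_def smooth_def const_form_def of_class_C_const)
  show "closed_form (const_form Q)"
    by (simp add: closed_form_def ext_deriv_def const_form_def)
  \<comment> \<open>The coefficient matrix is \<open>\<i> / 2\<close> times the Gram matrix of the
    columns of \<open>Q\<close>, as obtained by expanding the pulled-back standard form.\<close>
  define h where
    "h k l = (\<Sum>j\<in>UNIV. \<i> / 2 * complex_of_real (Q $ j $ k) * complex_of_real (Q $ j $ l))" for k l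
  have Im_cnj: "complex_of_real (Im (cnj a * b)) = \<i> / 2 * (a * cnj b - b * cnj a)" for a b
    by (simp add: complex_eq_iff)
  have prod: "cmat Q u $ j * cnj (cmat Q v $ j) = (\<Sum>k\<in>UNIV. \<Sum>l\<in>UNIV.
      complex_of_real (Q $ j $ k) * complex_of_real (Q $ j $ l) * (u $ k * cnj (v $ l)))" for u v j
    unfolding cmat_def vec_lambda_beta cnj_sum sum_product
    by (intro sum.cong refl) simp
  have "complex_of_real (const_form Q p u v) =
    (\<Sum>k\<in>UNIV. \<Sum>l\<in>UNIV. h k l * wedge (dz k) (dzbar l) u v)" for p u v
  proof -
    have "complex_of_real (const_form Q p u v) = (\<Sum>j\<in>UNIV. \<Sum>k\<in>UNIV. \<Sum>l\<in>UNIV.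
        \<i> / 2 * complex_of_real (Q $ j $ k) * complex_of_real (Q $ j $ l)
          * wedge (dz k) (dzbar l) u v)"
      unfolding const_form_def of_real_sum Im_cnj prod sum_subtractf[symmetric] sum_distrib_left
      by (intro sum.cong refl) (simp add: wedge_def dz_def dzbar_def algebra_simps diff_divide_distrib)
    \<comment> \<open>Two exchanges move the sum over \<open>j\<close> innermost, where it becomes
      the coefficient \<open>h k l\<close>.\<close>
    also have "\<dots> = (\<Sum>k\<in>UNIV. \<Sum>j\<in>UNIV. \<Sum>l\<in>UNIV.
        \<i> / 2 * complex_of_real (Q $ j $ k) * complex_of_real (Q $ j $ l)
          * wedge (dz k) (dzbar l) u v)"
      by (rule sum.swap)
    also have "\<dots> = (\<Sum>k\<in>UNIV. \<Sum>l\<in>UNIV. \<Sum>j\<in>UNIV.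
        \<i> / 2 * complex_of_real (Q $ j $ k) * complex_of_real (Q $ j $ l)
          * wedge (dz k) (dzbar l) u v)"
      by (intro sum.cong refl sum.swap)
    finally show ?thesis by (simp add: h_def sum_distrib_right)
  qed
  then show "type_1_1 (const_form Q)"
    unfolding type_1_1_def by (intro exI[of _ "\<lambda>_. h"]) simp
  show "positive_form (const_form Q)"
    unfolding positive_form_def
  proof (intro allI impI)
    fix p u :: "complex^'n" assume "u \<noteq> 0"
    \<comment> \<open>Invertibility of \<open>Q\<close> makes \<open>cmat Q\<close> injective, so
      some coordinate of the image of \<open>u\<close> is nonzero and the sum of squares below is
      positive.\<close>
    have "cmat (matrix_inv Q) (cmat Q u) = u"
      using assms by (simp add: cmat_mult matrix_inv_left cmat_one)
    then obtain j where j: "cmat Q u $ j \<noteq> 0"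
      using \<open>u \<noteq> 0\<close> by (force simp: cmat_def vec_eq_iff)
    have "const_form Q p u (\<i> *s u) = (\<Sum>j\<in>UNIV. (cmod (cmat Q u $ j))\<^sup>2)"
      by (simp add: const_form_def cmat_scale cmod_power2 flip: power2_eq_square)
    also have "\<dots> > 0"
      using j by (intro sum_pos2[of _ j]) auto
    finally show "const_form Q p u (\<i> *s u) > 0" .
  qed
qed

text \<open>The map \<open>cmat Q\<close> sends the real plane into itself and
  \<open>S_plane A\<close> into a product of real lines, the \<open>j\<close>-th spanned by
  \<open>D $ j $ j + \<i>\<close>. Two real multiples \<open>a\<close>, \<open>b\<close> of one
  complex number satisfy \<open>Im (cnj a * b) = 0\<close>.\<close>

lemma lagrangian_const_form:
  fixes Q D A :: "real^'n^'n::finite"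
  assumes D: "\<And>i j. i \<noteq> j \<Longrightarrow> D $ i $ j = 0" and QA: "Q ** A = D ** Q"
  shows "lagrangian_union (const_form Q) real_plane (S_plane A)"
  unfolding lagrangian_union_def pullback_vanishes_on_def
proof (intro conjI ballI)
  fix p u v :: "complex^'n" assume "u \<in> real_plane" "v \<in> real_plane"
  then show "const_form Q p u v = 0"
    by (simp add: const_form_def real_plane_def cmat_def)
next
  have diag: "(D *v x) $ j = D $ j $ j * x $ j" for x j
  proof -
    have "(D *v x) $ j = (\<Sum>k\<in>UNIV. if k = j then D $ j $ j * x $ j else 0)"
      unfolding matrix_vector_mult_def vec_lambda_beta using D by (intro sum.cong) auto
    then show ?thesis by simp
  qed
  have *: "cmat Q (complexify (A *v x) + \<i> *s complexify x) $ j =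
      complex_of_real ((Q *v x) $ j) * (complex_of_real (D $ j $ j) + \<i>)" for x j
  proof -
    have "Q *v (A *v x) = D *v (Q *v x)" by (simp add: matrix_vector_mul_assoc QA)
    then show ?thesis
      by (simp add: cmat_add cmat_scale cmat_complexify) (simp add: complexify_def diag algebra_simps)
  qed
  fix p u v :: "complex^'n" assume "u \<in> S_plane A" "v \<in> S_plane A"
  then show "const_form Q p u v = 0"
    by (auto simp: S_plane_def const_form_def * algebra_simps)
qed

theorem proposition3p2:
  fixes A :: "real^'n::finite^'n::finite"
  shows "(\<exists>\<omega> :: 'n form2. kaehler_form \<omega> \<and> lagrangian_union \<omega> real_plane (S_plane A))
         \<longleftrightarrow> diagonalizable_over_reals A"
proof
  assume "\<exists>\<omega> :: 'n form2. kaehler_form \<omega> \<and> lagrangian_union \<omega> real_plane (S_plane A)"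
  then show "diagonalizable_over_reals A"
    using lagrangian_imp_diagonalizable by blast
next
  assume "diagonalizable_over_reals A"
  then obtain P D :: "real^'n^'n" where P: "invertible P"
    and D: "\<And>i j. i \<noteq> j \<Longrightarrow> D $ i $ j = 0" and A: "A = P ** D ** matrix_inv P"
    unfolding diagonalizable_over_reals_def by blast
  \<comment> \<open>The form is taken with \<open>Q = matrix_inv P\<close>, the change to
    eigenvector coordinates, for which \<open>Q ** A = D ** Q\<close>.\<close>
  have "invertible (matrix_inv P)"
    using P matrix_inv_left matrix_inv_right unfolding invertible_def by blast
  moreover have "matrix_inv P ** A = D ** matrix_inv P"
    unfolding A using matrix_inv_left[OF P] by (simp add: matrix_mul_assoc)
  ultimately show "\<exists>\<omega> :: 'n form2. kaehler_form \<omega> \<and> lagrangian_union \<omega> real_plane (S_plane A)"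
    using kaehler_const_form lagrangian_const_form D by blast
qed

end
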